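(* Let $m \geq 1$ be an integer and let $G \in ER(n,d,\lambda)$ have a uniform shared neighborhood structure isomorphic to $H$. Then $D_m(G) \in ER(mn,md,m\lambda)$ and $D_m(G)$ has a uniform shared neighborhood structure isomorphic to $D_m(H)$.
   Context: For a graph $G$ with $V(G)=\{v_1,\dots,v_n\}$ and a positive integer $m$, the $m$-th shadow graph $D_m(G)$ has vertex set $\{v^i_j : i\in[m], j\in[n]\}$, with $v^i_j \sim v^k_l$ iff $v_j\sim v_l$ in $G$ (for any $i,k\in[m]$). For a finite simple graph $G$, $N(u)$ is the open neighborhood of $u$. $G \in ER(n,d,\lambda)$ means $G$ has $n$ vertices, is $d$-regular, and every pair of adjacent vertices has exactly $\lambda$ common neighbors. $G$ has a uniform shared neighborhood structure isomorphic to $H$ if the induced subgraph $G[N(u)\cap N(v)]$ is isomorphic to $H$ for all adjacent $u,v$. *)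

theory Defs
  imports "Graph_Theory.Pair_Digraph" "Graph_Theory.Digraph_Isomorphism"
begin

text \<open>
  Finite simple graphs are modelled by the locale predicate \<^const>\<open>pair_graph\<close>: a finite vertex
  set together with a symmetric, irreflexive set of ordered pairs, an undirected edge being
  represented by both of its orientations.
\<close>

definition nbhd :: "'a pair_pre_digraph \<Rightarrow> 'a \<Rightarrow> 'a set" where
  "nbhd G u = {v. (u, v) \<in> parcs G}"

definition ER :: "nat \<Rightarrow> nat \<Rightarrow> nat \<Rightarrow> 'a pair_pre_digraph set" where
  "ER n d l = {G. pair_graph G \<and> card (pverts G) = n \<and>
     (\<forall>u \<in> pverts G. card (nbhd G u) = d) \<and>
     (\<forall>u v. (u, v) \<in> parcs G \<longrightarrow> card (nbhd G u \<inter> nbhd G v) = l)}"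

definition uniform_shared_nbhd :: "'a pair_pre_digraph \<Rightarrow> 'b pair_pre_digraph \<Rightarrow> bool" where
  "uniform_shared_nbhd G H \<longleftrightarrow> pair_graph G \<and> pair_graph H \<and>
     (\<forall>u v. (u, v) \<in> parcs G \<longrightarrow>
        digraph_iso (with_proj G \<restriction> (nbhd G u \<inter> nbhd G v)) (with_proj H))"

text \<open>The pair \<open>(i, x)\<close> is the \<open>i\<close>-th copy of the vertex \<open>x\<close>.\<close>

definition shadow :: "nat \<Rightarrow> 'a pair_pre_digraph \<Rightarrow> (nat \<times> 'a) pair_pre_digraph" where
  "shadow m G = \<lparr> pverts = {1..m} \<times> pverts G,
     parcs = {((i, x), (k, y)) | i x k y. i \<in> {1..m} \<and> k \<in> {1..m} \<and> (x, y) \<in> parcs G} \<rparr>"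

end

theory Submission
  imports Defs
begin

text \<open>
  Every adjacency in \<open>D\<^sub>m(G)\<close> ignores the copy index, so neighborhoods, common neighborhoods and the
  subgraphs they induce are all \<open>m\<close>-fold blow-ups: \<open>N(i, x) = [m] \<times> N(x)\<close>, and
  \<open>D\<^sub>m(G)[[m] \<times> S] = D\<^sub>m(G[S])\<close>. It remains to note that \<open>D\<^sub>m\<close> preserves isomorphism.
\<close>

text \<open>Taking the induced subgraph before \<open>with_proj\<close> is applied keeps it a
  \<open>pair_pre_digraph\<close>, so that \<open>shadow\<close> can act on it.\<close>

definition induced :: "'a pair_pre_digraph \<Rightarrow> 'a set \<Rightarrow> 'a pair_pre_digraph" where
  "induced G S = \<lparr> pverts = S, parcs = {e \<in> parcs G. fst e \<in> S \<and> snd e \<in> S} \<rparr>"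

lemma induce_subgraph_with_proj: "with_proj G \<restriction> S = with_proj (induced G S)"
  by (simp add: induce_subgraph_def induced_def with_proj_def)

text \<open>A \<open>digraph_iso\<close> carries separate maps for vertices, arcs, tails and heads.
  For graphs of the form \<open>with_proj\<close> an arc is the pair of its endpoints, so the vertex
  map determines all the rest.\<close>

lemma digraph_iso_with_proj_iff:
  "digraph_iso (with_proj G) (with_proj H) \<longleftrightarrow>
    pair_wf_digraph G \<and>
    (\<exists>f. inj_on f (pverts G) \<and> pverts H = f ` pverts G \<and> parcs H = map_prod f f ` parcs G)"
  (is "?L \<longleftrightarrow> ?R")
proof
  assume ?L
  then obtain h where h: "pre_digraph.digraph_isomorphism (with_proj G) h"
    and H: "with_proj H = app_iso h (with_proj G)"
    by (auto simp: digraph_iso_def)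
  have wf: "pair_wf_digraph G" and inj: "inj_on (iso_verts h) (pverts G)"
    and ends: "\<And>a. a \<in> parcs G \<Longrightarrow> iso_verts h (fst a) = iso_tail h (iso_arcs h a) \<and>
      iso_verts h (snd a) = iso_head h (iso_arcs h a)"
    using h by (auto simp: pre_digraph.digraph_isomorphism_def wf_digraph_wp_iff)
  \<comment> \<open>Comparing the two records field by field also fixes the tail and head maps as
    the projections of \<open>with_proj H\<close>.\<close>
  have verts: "pverts H = iso_verts h ` pverts G" and arcs: "parcs H = iso_arcs h ` parcs G"
    and tail: "iso_tail h = fst" and head: "iso_head h = snd"
    using H by (simp_all add: with_proj_def app_iso_def)
  have "iso_arcs h a = map_prod (iso_verts h) (iso_verts h) a" if "a \<in> parcs G" for a
    using ends[OF that] by (simp add: tail head prod_eq_iff)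
  then have "parcs H = map_prod (iso_verts h) (iso_verts h) ` parcs G"
    unfolding arcs by (intro image_cong) auto
  with wf inj verts show ?R by blast
next
  assume ?R
  then obtain f where wf: "pair_wf_digraph G" and inj: "inj_on f (pverts G)"
    and verts: "pverts H = f ` pverts G" and arcs: "parcs H = map_prod f f ` parcs G"
    by blast
  let ?h = "\<lparr> iso_verts = f, iso_arcs = map_prod f f, iso_head = snd, iso_tail = fst \<rparr>"
  \<comment> \<open>Injectivity of \<open>f\<close> is known only on \<open>pverts G\<close>, so it
    passes to arcs because both endpoints lie there.\<close>
  have "parcs G \<subseteq> pverts G \<times> pverts G"
    using wf by (force simp: pair_wf_digraph_def)
  then have "inj_on (map_prod f f) (parcs G)"
    using map_prod_inj_on[OF inj inj] by (rule inj_on_subset[rotated])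
  then have "pre_digraph.digraph_isomorphism (with_proj G) ?h"
    using wf inj by (auto simp: pre_digraph.digraph_isomorphism_def wf_digraph_wp_iff)
  moreover have "with_proj H = app_iso ?h (with_proj G)"
    by (simp add: with_proj_def app_iso_def verts arcs)
  ultimately show ?L
    unfolding digraph_iso_def by blast
qed

lemma pverts_shadow [simp]: "pverts (shadow m G) = {1..m} \<times> pverts G"
  by (simp add: shadow_def)

lemma in_parcs_shadow_iff [simp]:
  "((i, x), (k, y)) \<in> parcs (shadow m G) \<longleftrightarrow> i \<in> {1..m} \<and> k \<in> {1..m} \<and> (x, y) \<in> parcs G"
  by (auto simp: shadow_def)

lemma nbhd_shadow: "i \<in> {1..m} \<Longrightarrow> nbhd (shadow m G) (i, x) = {1..m} \<times> nbhd G x"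
  by (auto simp: nbhd_def)

lemma induced_shadow: "induced (shadow m G) ({1..m} \<times> S) = shadow m (induced G S)"
  by (auto simp: induced_def shadow_def)

lemma pair_wf_digraph_shadow:
  assumes "pair_wf_digraph G"
  shows "pair_wf_digraph (shadow m G)"
  using assms by (force simp: pair_wf_digraph_def shadow_def)

lemma pair_graph_shadow:
  assumes "pair_graph G"
  shows "pair_graph (shadow m G)"
proof -
  interpret pair_graph G by fact
  interpret D: pair_wf_digraph "shadow m G"
    by (rule pair_wf_digraph_shadow) (rule pair_wf_digraph)
  have fin: "finite (pverts (shadow m G))"
    by simp
  \<comment> \<open>The arc set is finite as a subset of the square of the finite vertex
    set.\<close>
  have "parcs (shadow m G) \<subseteq> pverts (shadow m G) \<times> pverts (shadow m G)"
    using D.arc_fst_in_verts D.arc_snd_in_verts by (force simp del: pverts_shadow)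
  then have "finite (parcs (shadow m G))"
    by (rule finite_subset) (use fin in blast)
  moreover have "symmetric (with_proj (shadow m G))"
    using pair_sym_arcs by (auto simp: symmetric_def sym_def)
  moreover have "fst e \<noteq> snd e" if "e \<in> parcs (shadow m G)" for e
    using that pair_no_loops by (fastforce simp: shadow_def)
  ultimately show ?thesis
    using fin by unfold_locales auto
qed

text \<open>The isomorphism lifts by acting on the base vertex and fixing the copy index, on which
  adjacency does not depend.\<close>

lemma digraph_iso_shadow:
  assumes "digraph_iso (with_proj G) (with_proj H)"
  shows "digraph_iso (with_proj (shadow m G)) (with_proj (shadow m H))"
proof -
  obtain f where wf: "pair_wf_digraph G" and inj: "inj_on f (pverts G)"
    and verts: "pverts H = f ` pverts G" and arcs: "parcs H = map_prod f f ` parcs G"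
    using assms by (auto simp: digraph_iso_with_proj_iff)
  let ?g = "map_prod id f :: nat \<times> 'a \<Rightarrow> nat \<times> 'b"
  have "inj_on ?g (pverts (shadow m G))"
    using map_prod_inj_on[OF inj_on_id inj] by simp
  moreover have "pverts (shadow m H) = ?g ` pverts (shadow m G)"
    by (simp add: verts map_prod_surj_on)
  moreover have "parcs (shadow m H) = map_prod ?g ?g ` parcs (shadow m G)"
  proof
    show "parcs (shadow m H) \<subseteq> map_prod ?g ?g ` parcs (shadow m G)"
    proof
      fix e assume "e \<in> parcs (shadow m H)"
      then obtain i x k y where "e = ((i, f x), (k, f y))"
        and "((i, x), (k, y)) \<in> parcs (shadow m G)"
        by (auto simp: shadow_def arcs)
      then show "e \<in> map_prod ?g ?g ` parcs (shadow m G)"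
        by (intro image_eqI[where x = "((i, x), (k, y))"]) auto
    qed
    show "map_prod ?g ?g ` parcs (shadow m G) \<subseteq> parcs (shadow m H)"
      by (auto simp: shadow_def arcs)
  qed
  ultimately show ?thesis
    using pair_wf_digraph_shadow[OF wf] unfolding digraph_iso_with_proj_iff by blast
qed

text \<open>An arc of the shadow projects to an arc of \<open>G\<close>. The common neighborhood of
  its ends is therefore \<open>{1..m}\<close> times one in \<open>G\<close>, and each count is
  multiplied by \<open>m\<close>.\<close>

lemma shadow_in_ER:
  assumes "G \<in> ER n d l"
  shows "shadow m G \<in> ER (m * n) (m * d) (m * l)"
  using assms
  by (auto simp: ER_def pair_graph_shadow card_cartesian_product nbhd_shadow Times_Int_Times)

lemma uniform_shared_nbhd_shadow:
  assumes "uniform_shared_nbhd G H"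
  shows "uniform_shared_nbhd (shadow m G) (shadow m H)"
  using assms
  \<comment> \<open>Removing \<open>One_nat_def\<close> stops \<open>{1..m}\<close> from becoming
    \<open>{Suc 0..m}\<close>, which the left-hand side of \<open>induced_shadow\<close> would not
    match.\<close>
  by (auto simp: uniform_shared_nbhd_def pair_graph_shadow nbhd_shadow Times_Int_Times
      induce_subgraph_with_proj induced_shadow simp del: One_nat_def intro!: digraph_iso_shadow)

theorem theorem9:
  fixes G :: "'a pair_pre_digraph" and H :: "'b pair_pre_digraph" and m n d l :: nat
  assumes "m \<ge> 1"
    and "G \<in> ER n d l"
    and "uniform_shared_nbhd G H"
  shows "shadow m G \<in> ER (m * n) (m * d) (m * l) \<and> uniform_shared_nbhd (shadow m G) (shadow m H)"
  using assms(2,3) by (simp add: shadow_in_ER uniform_shared_nbhd_shadow)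

end
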